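(* Let $\mathbf{k}$ be a commutative ring, $q\in\mathbf{k}$ and $r:=q+1$. Let $T$ be a set of compositions, and let $\mathrm{QSym}_T^{(q)}$ be the $\mathbf{k}$-submodule of $\mathrm{QSym}$ spanned by the family $\left(\eta_\alpha^{(q)}\right)_{\alpha\in T}$. For any subset $Y$ of $\{1,2,3,\ldots\}$, let $Y^*$ denote the set of all compositions whose entries all belong to $Y$. (a) If $T=Y^*$ for some subset $Y$ of $\{1,2,3,\ldots\}$, then $\mathrm{QSym}_T^{(q)}$ is a subcoalgebra of $\mathrm{QSym}$. (b) More generally: If $T$ has the property that every two compositions $\beta$ and $\gamma$ satisfying $\beta\gamma\in T$ satisfy $\beta\in T$ and $\gamma\in T$, then $\mathrm{QSym}_T^{(q)}$ is a subcoalgebra of $\mathrm{QSym}$. (c) If $\mathbf{k}$ is a field and $r\ne 0$, then the converse of part (b) holds as well: If $\mathrm{QSym}_T^{(q)}$ is a subcoalgebra of $\mathrm{QSym}$, then every two compositions $\beta$ and $\gamma$ satisfying $\beta\gamma\in T$ satisfy $\beta\in T$ and $\gamma\in T$.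
   Context: For an integer $m$, $[m]=\{1,2,\ldots,m\}$ (empty if $m\le 0$). A composition is a finite tuple $\alpha=(\alpha_1,\ldots,\alpha_k)$ of positive integers; its length is $\ell(\alpha)=k$, its size is $|\alpha|=\alpha_1+\cdots+\alpha_k$. $\mathrm{Comp}$ is the set of all compositions (including the empty one), and $\mathrm{Comp}_n$ the set of compositions of size $n$. $\beta\gamma$ denotes the concatenation of compositions $\beta$ and $\gamma$ (the entries of $\beta$ followed by those of $\gamma$). For $\alpha=(\alpha_1,\ldots,\alpha_k)\in\mathrm{Comp}_n$ set $D(\alpha)=\{\alpha_1+\cdots+\alpha_i \mid i\in[k-1]\}\subseteq[n-1]$. $\mathrm{QSym}$ is the Hopf algebra of quasisymmetric functions over $\mathbf{k}$ (a $\mathbf{k}$-subalgebra of $\mathbf{k}[[x_1,x_2,\ldots]]$). It has the $\mathbf{k}$-basis $(M_\alpha)_{\alpha\in\mathrm{Comp}}$ with $M_\alpha=\sum_{i_1<i_2<\cdots<i_\ell}x_{i_1}^{\alpha_1}\cdots x_{i_\ell}^{\alpha_\ell}$ for $\alpha=(\alpha_1,\ldots,\alpha_\ell)$. Its coproduct is the $\mathbf{k}$-linear map $\Delta$ with $\Delta(M_\alpha)=\sum_{\beta,\gamma\in\mathrm{Comp};\ \alpha=\beta\gamma}M_\beta\otimes M_\gamma$. For $\alpha\in\mathrm{Comp}_n$, $\eta_\alpha^{(q)}=\sum_{\beta\in\mathrm{Comp}_n;\ D(\beta)\subseteq D(\alpha)}r^{\ell(\beta)}M_\beta\in\mathrm{QSym}$.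 Convention: a "subcoalgebra" of a $\mathbf{k}$-coalgebra $C$ here means a $\mathbf{k}$-submodule $D$ of $C$ such that $\Delta(D)$ is contained in the image of the canonical map $D\otimes D\to C\otimes C$. *)

theory Defs
  imports Complex_Main "HOL-Library.Poly_Mapping"
begin

section \<open>Compositions\<close>

definition Comp :: "nat list set"
  where "Comp = {\<alpha>. \<forall>a\<in>set \<alpha>. a > 0}"

definition Comp_of_size :: "nat \<Rightarrow> nat list set"
  where "Comp_of_size n = {\<alpha>\<in>Comp. sum_list \<alpha> = n}"

definition partial_sums :: "nat list \<Rightarrow> nat set"
  where "partial_sums \<alpha> = {sum_list (take i \<alpha>) | i. i \<in> {1..length \<alpha> - 1}}"

definition comp_star :: "nat set \<Rightarrow> nat list set"
  where "comp_star Y = {\<alpha>\<in>Comp. set \<alpha> \<subseteq> Y}"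

definition comp_splits :: "nat list \<Rightarrow> (nat list \<times> nat list) set"
  where "comp_splits \<alpha> = {(\<beta>, \<gamma>). \<beta> \<in> Comp \<and> \<gamma> \<in> Comp \<and> \<alpha> = \<beta> @ \<gamma>}"

lemma length_le_sum_list: "\<alpha> \<in> Comp \<Longrightarrow> length \<alpha> \<le> sum_list \<alpha>"
  by (induction \<alpha>) (auto simp: Comp_def Suc_le_eq intro: add_less_le_mono)

lemma finite_Comp_le: "finite {\<alpha>\<in>Comp. sum_list \<alpha> \<le> d}"
proof (rule finite_subset)
  show "{\<alpha>\<in>Comp. sum_list \<alpha> \<le> d} \<subseteq> {\<alpha>. set \<alpha> \<subseteq> {0..d} \<and> length \<alpha> \<le> d}"
    using length_le_sum_list member_le_sum_list by (fastforce intro: order_trans)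
  show "finite {\<alpha>. set \<alpha> \<subseteq> {0..d} \<and> length \<alpha> \<le> d}"
    by (rule finite_lists_length_le) simp
qed

lemma finite_Comp_of_size: "finite (Comp_of_size n)"
  by (rule finite_subset[OF _ finite_Comp_le[of n]]) (auto simp: Comp_of_size_def)

lemma finite_comp_splits: "finite (comp_splits \<alpha>)"
proof (rule finite_subset)
  show "comp_splits \<alpha> \<subseteq> (\<lambda>i. (take i \<alpha>, drop i \<alpha>)) ` {..length \<alpha>}"
  proof clarify
    fix \<beta> \<gamma> assume "(\<beta>, \<gamma>) \<in> comp_splits \<alpha>"
    then have "\<alpha> = \<beta> @ \<gamma>" by (simp add: comp_splits_def)
    then show "(\<beta>, \<gamma>) \<in> (\<lambda>i. (take i \<alpha>, drop i \<alpha>)) ` {..length \<alpha>}"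
      by (intro image_eqI[of _ _ "length \<beta>"]) simp_all
  qed
qed simp


section \<open>Quasisymmetric functions\<close>

text \<open>A monomial is its finitely supported family of exponents. The variables are indexed from
  \<open>0\<close>, so that index \<open>i\<close> stands for the variable \<open>x\<^sub>i\<^sub>+\<^sub>1\<close>. A formal power series (of possibly
  unbounded degree, in infinitely many variables) is its family of coefficients.\<close>

type_synonym monomial = "nat \<Rightarrow>\<^sub>0 nat"
type_synonym 'k power_series = "monomial \<Rightarrow> 'k"

definition mon_deg :: "monomial \<Rightarrow> nat"
  where "mon_deg m = (\<Sum>i\<in>Poly_Mapping.keys m. Poly_Mapping.lookup m i)"

definition mon :: "nat list \<Rightarrow> nat list \<Rightarrow> monomial"
  where "mon is \<alpha> = sum_list (map2 Poly_Mapping.single is \<alpha>)"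

definition quasisymmetric :: "'k power_series \<Rightarrow> bool"
  where "quasisymmetric f \<longleftrightarrow>
    (\<forall>\<alpha>\<in>Comp. \<forall>is js. sorted_wrt (<) is \<and> sorted_wrt (<) js \<and>
        length is = length \<alpha> \<and> length js = length \<alpha> \<longrightarrow> f (mon is \<alpha>) = f (mon js \<alpha>))"

definition bounded_degree :: "'k::zero power_series \<Rightarrow> bool"
  where "bounded_degree f \<longleftrightarrow> (\<exists>d. \<forall>m. f m \<noteq> 0 \<longrightarrow> mon_deg m \<le> d)"

typedef (overloaded) 'k qsym = "{f :: 'k::comm_ring_1 power_series. quasisymmetric f \<and> bounded_degree f}"
  by (rule exI[of _ "\<lambda>_. 0"]) (simp add: quasisymmetric_def bounded_degree_def)

setup_lifting type_definition_qsym

lemma bounded_degree_combine: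
  assumes "bounded_degree f" "bounded_degree g" "\<And>m. f m = 0 \<Longrightarrow> g m = 0 \<Longrightarrow> h m = 0"
  shows "bounded_degree h"
proof -
  obtain d e where "\<forall>m. f m \<noteq> 0 \<longrightarrow> mon_deg m \<le> d" "\<forall>m. g m \<noteq> 0 \<longrightarrow> mon_deg m \<le> e"
    using assms unfolding bounded_degree_def by blast
  then have "\<forall>m. h m \<noteq> 0 \<longrightarrow> mon_deg m \<le> max d e"
    using assms(3) by (metis max.coboundedI1 max.coboundedI2)
  then show ?thesis unfolding bounded_degree_def by blast
qed

instantiation qsym :: (comm_ring_1) ab_group_add
begin

lift_definition zero_qsym :: "'a qsym" is "\<lambda>_. 0"
  by (simp add: quasisymmetric_def bounded_degree_def)

lift_definition plus_qsym :: "'a qsym \<Rightarrow> 'a qsym \<Rightarrow> 'a qsym" is "\<lambda>f g m. f m + g m"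
proof -
  fix f g :: "'a power_series"
  assume fg: "quasisymmetric f \<and> bounded_degree f" "quasisymmetric g \<and> bounded_degree g"
  then show "quasisymmetric (\<lambda>m. f m + g m) \<and> bounded_degree (\<lambda>m. f m + g m)"
    using bounded_degree_combine[of f g "\<lambda>m. f m + g m"]
    by (simp add: quasisymmetric_def) metis
qed

lift_definition minus_qsym :: "'a qsym \<Rightarrow> 'a qsym \<Rightarrow> 'a qsym" is "\<lambda>f g m. f m - g m"
proof -
  fix f g :: "'a power_series"
  assume fg: "quasisymmetric f \<and> bounded_degree f" "quasisymmetric g \<and> bounded_degree g"
  then show "quasisymmetric (\<lambda>m. f m - g m) \<and> bounded_degree (\<lambda>m. f m - g m)"
    using bounded_degree_combine[of f g "\<lambda>m. f m - g m"]
    by (simp add: quasisymmetric_def) metis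
qed

lift_definition uminus_qsym :: "'a qsym \<Rightarrow> 'a qsym" is "\<lambda>f m. - f m"
  by (auto simp: quasisymmetric_def bounded_degree_def)

instance
  by standard (transfer; simp add: fun_eq_iff)+

end

lift_definition scale_qsym :: "'k::comm_ring_1 \<Rightarrow> 'k qsym \<Rightarrow> 'k qsym" is "\<lambda>c f m. c * f m"
proof -
  fix c :: 'k and f :: "'k power_series"
  assume f: "quasisymmetric f \<and> bounded_degree f"
  show "quasisymmetric (\<lambda>m. c * f m) \<and> bounded_degree (\<lambda>m. c * f m)"
    using f bounded_degree_combine[of f f "\<lambda>m. c * f m"] by (simp add: quasisymmetric_def) metis
qed

global_interpretation qsym: module "scale_qsym :: 'k::comm_ring_1 \<Rightarrow> _"
  by unfold_locales (transfer; simp add: fun_eq_iff algebra_simps)+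


section \<open>The monomial basis\<close>

definition M_series :: "nat list \<Rightarrow> 'k::comm_ring_1 power_series"
  where "M_series \<alpha> m =
    of_nat (card {is. sorted_wrt (<) is \<and> length is = length \<alpha> \<and> mon is \<alpha> = m})"

text \<open>Only meaningful for compositions: for other lists \<open>M_series\<close> need not be quasisymmetric.\<close>

definition M :: "nat list \<Rightarrow> 'k::comm_ring_1 qsym"
  where "M \<alpha> = Abs_qsym (M_series \<alpha>)"

lemma mon_Cons: "mon (i # is) (a # \<alpha>) = Poly_Mapping.single i a + mon is \<alpha>"
  by (simp add: mon_def)

lemma lookup_mon_notin:
  "length is = length \<alpha> \<Longrightarrow> k \<notin> set is \<Longrightarrow> Poly_Mapping.lookup (mon is \<alpha>) k = 0"
  by (induction "is" \<alpha> rule: list_induct2)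
     (auto simp: mon_Cons lookup_add lookup_single when_def, simp add: mon_def)

lemma map_lookup_mon:
  "length is = length \<alpha> \<Longrightarrow> distinct is \<Longrightarrow> map (Poly_Mapping.lookup (mon is \<alpha>)) is = \<alpha>"
proof (induction "is" \<alpha> rule: list_induct2)
  case (Cons i "is" a \<alpha>)
  have "map (Poly_Mapping.lookup (mon (i # is) (a # \<alpha>))) is = map (Poly_Mapping.lookup (mon is \<alpha>)) is"
    using Cons.prems by (auto simp: mon_Cons lookup_add lookup_single when_def)
  moreover have "Poly_Mapping.lookup (mon (i # is) (a # \<alpha>)) i = a"
    using Cons by (simp add: mon_Cons lookup_add lookup_mon_notin)
  ultimately show ?case
    using Cons by (simp only: list.map distinct.simps)
qed simp

lemma keys_mon:
  assumes "\<alpha> \<in> Comp" "length is = length \<alpha>" "distinct is"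
  shows "Poly_Mapping.keys (mon is \<alpha>) = set is"
proof -
  have "Poly_Mapping.lookup (mon is \<alpha>) k \<in> set \<alpha>" if "k \<in> set is" for k
    using map_lookup_mon[OF assms(2,3)] that by (metis image_eqI image_set)
  then have "Poly_Mapping.lookup (mon is \<alpha>) k \<noteq> 0" if "k \<in> set is" for k
    using assms(1) that by (metis Comp_def less_irrefl mem_Collect_eq)
  then have "Poly_Mapping.lookup (mon is \<alpha>) k \<noteq> 0 \<longleftrightarrow> k \<in> set is" for k
    using lookup_mon_notin[OF assms(2)] by metis
  then show ?thesis by (simp add: set_eq_iff in_keys_iff)
qed

lemma mon_deg_mon:
  assumes "\<alpha> \<in> Comp" "length is = length \<alpha>" "distinct is"
  shows "mon_deg (mon is \<alpha>) = sum_list \<alpha>"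
  using map_lookup_mon[OF assms(2,3)] sum_list_distinct_conv_sum_set[OF assms(3)]
  by (metis keys_mon[OF assms] mon_deg_def)

lemma mon_inject:
  assumes "\<alpha> \<in> Comp" "length is = length \<alpha>" "sorted_wrt (<) is"
    and "\<beta> \<in> Comp" "length js = length \<beta>" "sorted_wrt (<) js"
    and eq: "mon is \<alpha> = mon js \<beta>"
  shows "is = js" "\<alpha> = \<beta>"
proof -
  have d: "distinct is" "distinct js"
    using assms strict_sorted_iff by blast+
  have "set is = set js"
    using keys_mon assms d by metis
  then show "is = js"
    using assms strict_sorted_equal by blast
  then show "\<alpha> = \<beta>"
    using map_lookup_mon assms d by metis
qed

lemma mon_surj:
  obtains \<alpha> "is" where "\<alpha> \<in> Comp" "length is = length \<alpha>" "sorted_wrt (<) is" "m = mon is \<alpha>"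
proof
  let ?is = "sorted_list_of_set (Poly_Mapping.keys m)"
  let ?\<alpha> = "map (Poly_Mapping.lookup m) ?is"
  show C: "?\<alpha> \<in> Comp" by (auto simp: Comp_def in_keys_iff)
  show l: "length ?is = length ?\<alpha>" and "sorted_wrt (<) ?is" by simp_all
  have "map (Poly_Mapping.lookup (mon ?is ?\<alpha>)) ?is = ?\<alpha>"
    by (rule map_lookup_mon) simp_all
  then have "Poly_Mapping.lookup (mon ?is ?\<alpha>) k = Poly_Mapping.lookup m k"
    if "k \<in> Poly_Mapping.keys m" for k
    using that by simp
  moreover have "Poly_Mapping.lookup (mon ?is ?\<alpha>) k = Poly_Mapping.lookup m k"
    if "k \<notin> Poly_Mapping.keys m" for k
    using that lookup_mon_notin[OF l, of k] by (simp add: in_keys_iff)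
  ultimately show "m = mon ?is ?\<alpha>" by (metis poly_mapping_eqI)
qed

lemma M_series_mon:
  assumes "\<alpha> \<in> Comp" "\<beta> \<in> Comp" "length is = length \<beta>" "sorted_wrt (<) is"
  shows "M_series \<alpha> (mon is \<beta>) = (if \<alpha> = \<beta> then 1 else 0)"
proof -
  have "{js. sorted_wrt (<) js \<and> length js = length \<alpha> \<and> mon js \<alpha> = mon is \<beta>}
      = (if \<alpha> = \<beta> then {is} else {})"
    using assms mon_inject by auto
  then show ?thesis by (simp add: M_series_def)
qed

lemma Rep_M:
  assumes "\<alpha> \<in> Comp"
  shows "Rep_qsym (M \<alpha>) = M_series \<alpha>"
proof -
  have "quasisymmetric (M_series \<alpha>)"
    using assms by (simp add: quasisymmetric_def M_series_mon)
  moreover have "mon_deg m \<le> sum_list \<alpha>" if "M_series \<alpha> m \<noteq> 0" for m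
  proof -
    obtain \<beta> "is" where *: "\<beta> \<in> Comp" "length is = length \<beta>" "sorted_wrt (<) is" "m = mon is \<beta>"
      by (rule mon_surj)
    then have "\<alpha> = \<beta>" using assms that by (auto simp: M_series_mon split: if_splits)
    then show ?thesis using * mon_deg_mon strict_sorted_iff by (metis order_refl)
  qed
  ultimately show ?thesis
    unfolding M_def by (intro Abs_qsym_inverse) (auto simp: bounded_degree_def)
qed

text \<open>The coefficient of \<open>M \<alpha>\<close> is that of the monomial \<open>x\<^sub>1\<^bsup>\<alpha>\<^sub>1\<^esup> x\<^sub>2\<^bsup>\<alpha>\<^sub>2\<^esup> \<dots>\<close>.\<close>

definition M_coeff :: "nat list \<Rightarrow> 'k::comm_ring_1 qsym \<Rightarrow> 'k"
  where "M_coeff \<alpha> f = Rep_qsym f (mon [0..<length \<alpha>] \<alpha>)"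

lemma M_coeff_zero: "M_coeff \<alpha> 0 = 0"
  unfolding M_coeff_def by transfer simp

lemma M_coeff_add: "M_coeff \<alpha> (f + g) = M_coeff \<alpha> f + M_coeff \<alpha> g"
  unfolding M_coeff_def by transfer simp

lemma M_coeff_scale: "M_coeff \<alpha> (scale_qsym c f) = c * M_coeff \<alpha> f"
  unfolding M_coeff_def by transfer simp

lemma M_coeff_sum: "M_coeff \<alpha> (sum f A) = (\<Sum>x\<in>A. M_coeff \<alpha> (f x))"
  by (induction A rule: infinite_finite_induct) (auto simp: M_coeff_zero M_coeff_add)

lemma M_coeff_M:
  "\<alpha> \<in> Comp \<Longrightarrow> \<beta> \<in> Comp \<Longrightarrow> M_coeff \<beta> (M \<alpha>) = (if \<alpha> = \<beta> then 1 else 0)"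
  by (simp add: M_coeff_def Rep_M M_series_mon)

lemma qsym_eqI:
  assumes "\<And>\<alpha>. \<alpha> \<in> Comp \<Longrightarrow> M_coeff \<alpha> f = M_coeff \<alpha> g"
  shows "f = g"
proof -
  have "Rep_qsym f m = Rep_qsym g m" for m
  proof -
    obtain \<alpha> "is" where *: "\<alpha> \<in> Comp" "length is = length \<alpha>" "sorted_wrt (<) is" "m = mon is \<alpha>"
      by (rule mon_surj)
    have "Rep_qsym h m = M_coeff \<alpha> h" for h :: "'a qsym"
    proof -
      have q: "quasisymmetric (Rep_qsym h)" using Rep_qsym[of h] by blast
      have "sorted_wrt (<) [0..<length \<alpha>]" "length [0..<length \<alpha>] = length \<alpha>" by simp_all
      then show ?thesis
        using q * unfolding quasisymmetric_def M_coeff_def by metis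
    qed
    then show ?thesis using assms * by simp
  qed
  then show ?thesis by (metis Rep_qsym_inject ext)
qed

lemma finite_M_support: "finite {\<alpha>\<in>Comp. M_coeff \<alpha> f \<noteq> 0}"
proof -
  obtain d where d: "Rep_qsym f m \<noteq> 0 \<Longrightarrow> mon_deg m \<le> d" for m
    using Rep_qsym[of f] by (auto simp: bounded_degree_def)
  have "{\<alpha>\<in>Comp. M_coeff \<alpha> f \<noteq> 0} \<subseteq> {\<alpha>\<in>Comp. sum_list \<alpha> \<le> d}"
    using d mon_deg_mon by (fastforce simp: M_coeff_def)
  then show ?thesis using finite_Comp_le finite_subset by blast
qed

lemma M_expansion:
  "f = (\<Sum>\<alpha> | \<alpha> \<in> Comp \<and> M_coeff \<alpha> f \<noteq> 0. scale_qsym (M_coeff \<alpha> f) (M \<alpha>))"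
proof (rule qsym_eqI)
  fix \<beta> assume \<beta>: "\<beta> \<in> Comp"
  have "(\<Sum>\<alpha> | \<alpha> \<in> Comp \<and> M_coeff \<alpha> f \<noteq> 0. M_coeff \<beta> (scale_qsym (M_coeff \<alpha> f) (M \<alpha>)))
    = (\<Sum>\<alpha> | \<alpha> \<in> Comp \<and> M_coeff \<alpha> f \<noteq> 0. if \<alpha> = \<beta> then M_coeff \<alpha> f else 0)"
    using \<beta> by (intro sum.cong) (auto simp: M_coeff_scale M_coeff_M)
  also have "\<dots> = M_coeff \<beta> f"
    using \<beta> by (simp add: sum.delta finite_M_support)
  finally show "M_coeff \<beta> f
    = M_coeff \<beta> (\<Sum>\<alpha> | \<alpha> \<in> Comp \<and> M_coeff \<alpha> f \<noteq> 0. scale_qsym (M_coeff \<alpha> f) (M \<alpha>))"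
    by (simp add: M_coeff_sum)
qed

lemma M_inj: "inj_on (M :: _ \<Rightarrow> 'k::comm_ring_1 qsym) Comp"
  by (rule inj_onI) (metis M_coeff_M zero_neq_one)

lemma M_span: "qsym.span (M ` Comp) = UNIV"
proof -
  have "f \<in> qsym.span (M ` Comp)" for f
    by (subst M_expansion, intro qsym.span_sum qsym.span_scale, rule qsym.span_base) auto
  then show ?thesis by auto
qed

lemma M_independent: "qsym.independent (M ` Comp :: 'k::comm_ring_1 qsym set)"
  unfolding qsym.independent_explicit_module
proof (intro allI impI)
  fix t :: "'k qsym set" and u v
  assume t: "finite t" "t \<subseteq> M ` Comp" "(\<Sum>v\<in>t. scale_qsym (u v) v) = 0" "v \<in> t"
  then obtain \<alpha> where \<alpha>: "\<alpha> \<in> Comp" "v = M \<alpha>" by blast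
  have "0 = (\<Sum>w\<in>t. M_coeff \<alpha> (scale_qsym (u w) w))"
    using t(3) by (metis M_coeff_sum M_coeff_zero)
  also have "\<dots> = (\<Sum>w\<in>t. if w = v then u w else 0)"
    using t \<alpha> by (intro sum.cong) (auto simp: M_coeff_scale M_coeff_M)
  also have "\<dots> = u v" using t by simp
  finally show "u v = 0" by simp
qed


section \<open>The tensor square of QSym\<close>

text \<open>The free \<open>'k\<close>-module on a set of generators \<open>'a\<close> is \<open>'a \<Rightarrow>\<^sub>0 'k\<close>; the tensor square
  is the quotient of the free module on pairs by the bilinearity relations.\<close>

definition scale_free :: "'k::comm_ring_1 \<Rightarrow> ('a \<Rightarrow>\<^sub>0 'k) \<Rightarrow> ('a \<Rightarrow>\<^sub>0 'k)"
  where "scale_free c = Poly_Mapping.map ((*) c)"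

lemma lookup_scale_free: "Poly_Mapping.lookup (scale_free c x) a = c * Poly_Mapping.lookup x a"
  by (simp add: scale_free_def Poly_Mapping.map.rep_eq when_def)

global_interpretation free: module "scale_free :: 'k::comm_ring_1 \<Rightarrow> ('a \<Rightarrow>\<^sub>0 'k) \<Rightarrow> _"
  by unfold_locales
     (simp_all add: poly_mapping_eq_iff fun_eq_iff lookup_scale_free lookup_add algebra_simps)

definition bilinear_relators :: "('k::comm_ring_1 qsym \<times> 'k qsym \<Rightarrow>\<^sub>0 'k) set"
  where "bilinear_relators =
    (let e = (\<lambda>f g. Poly_Mapping.single (f, g) 1) in
      {e (f + f') g - e f g - e f' g | f f' g. True} \<union>
      {e f (g + g') - e f g - e f g' | f g g'. True} \<union>
      {e (scale_qsym c f) g - scale_free c (e f g) | c f g. True} \<union>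
      {e f (scale_qsym c g) - scale_free c (e f g) | c f g. True})"

definition tensor_rel ::
    "('k::comm_ring_1 qsym \<times> 'k qsym \<Rightarrow>\<^sub>0 'k) \<Rightarrow> ('k qsym \<times> 'k qsym \<Rightarrow>\<^sub>0 'k) \<Rightarrow> bool"
  where "tensor_rel x y \<longleftrightarrow> x - y \<in> free.span bilinear_relators"

quotient_type (overloaded) 'k qsym2 = "'k::comm_ring_1 qsym \<times> 'k qsym \<Rightarrow>\<^sub>0 'k" / tensor_rel
proof (rule equivpI)
  show "reflp (tensor_rel :: ('k qsym \<times> 'k qsym \<Rightarrow>\<^sub>0 'k) \<Rightarrow> _)"
    by (simp add: reflp_def tensor_rel_def free.span_zero)
  show "symp (tensor_rel :: ('k qsym \<times> 'k qsym \<Rightarrow>\<^sub>0 'k) \<Rightarrow> _)"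
    unfolding symp_def tensor_rel_def by (metis free.span_neg minus_diff_eq)
  show "transp (tensor_rel :: ('k qsym \<times> 'k qsym \<Rightarrow>\<^sub>0 'k) \<Rightarrow> _)"
    unfolding transp_def tensor_rel_def
  proof (intro allI impI)
    fix x y z :: "'k qsym \<times> 'k qsym \<Rightarrow>\<^sub>0 'k"
    assume "x - y \<in> free.span bilinear_relators" "y - z \<in> free.span bilinear_relators"
    from free.span_add[OF this] show "x - z \<in> free.span bilinear_relators" by simp
  qed
qed

instantiation qsym2 :: (comm_ring_1) ab_group_add
begin

lift_definition zero_qsym2 :: "'a qsym2" is 0 .

lift_definition plus_qsym2 :: "'a qsym2 \<Rightarrow> 'a qsym2 \<Rightarrow> 'a qsym2" is "(+)"
  unfolding tensor_rel_def by (drule (1) free.span_add) (simp add: algebra_simps)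

lift_definition minus_qsym2 :: "'a qsym2 \<Rightarrow> 'a qsym2 \<Rightarrow> 'a qsym2" is "(-)"
  unfolding tensor_rel_def by (drule (1) free.span_diff) (simp add: algebra_simps)

lift_definition uminus_qsym2 :: "'a qsym2 \<Rightarrow> 'a qsym2" is uminus
  unfolding tensor_rel_def by (drule free.span_neg) simp

instance
  by standard (transfer; simp add: tensor_rel_def free.span_zero algebra_simps)+

end

lift_definition scale_qsym2 :: "'k::comm_ring_1 \<Rightarrow> 'k qsym2 \<Rightarrow> 'k qsym2" is scale_free
  unfolding tensor_rel_def by (metis free.span_scale free.scale_right_diff_distrib)

global_interpretation qsym2: module "scale_qsym2 :: 'k::comm_ring_1 \<Rightarrow> _"
  by unfold_locales
     (transfer; simp add: tensor_rel_def free.span_zero free.scale_right_distrib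
        free.scale_left_distrib)+

definition tensor :: "'k::comm_ring_1 qsym \<Rightarrow> 'k qsym \<Rightarrow> 'k qsym2"  (infixl \<open>\<otimes>\<close> 70)
  where "f \<otimes> g = abs_qsym2 (Poly_Mapping.single (f, g) 1)"

lemma tensor_add_left: "(f + f') \<otimes> g = f \<otimes> g + f' \<otimes> g"
  unfolding tensor_def plus_qsym2.abs_eq qsym2.abs_eq_iff tensor_rel_def
  unfolding diff_diff_eq[symmetric] bilinear_relators_def Let_def
  by (rule free.span_base) blast

lemma tensor_add_right: "f \<otimes> (g + g') = f \<otimes> g + f \<otimes> g'"
  unfolding tensor_def plus_qsym2.abs_eq qsym2.abs_eq_iff tensor_rel_def
  unfolding diff_diff_eq[symmetric] bilinear_relators_def Let_def
  by (rule free.span_base) blast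

lemma tensor_scale_left: "scale_qsym c f \<otimes> g = scale_qsym2 c (f \<otimes> g)"
  unfolding tensor_def scale_qsym2.abs_eq qsym2.abs_eq_iff tensor_rel_def
  unfolding bilinear_relators_def Let_def
  by (rule free.span_base) blast

lemma tensor_scale_right: "f \<otimes> scale_qsym c g = scale_qsym2 c (f \<otimes> g)"
  unfolding tensor_def scale_qsym2.abs_eq qsym2.abs_eq_iff tensor_rel_def
  unfolding bilinear_relators_def Let_def
  by (rule free.span_base) blast


section \<open>The coproduct\<close>

definition coproduct :: "'k::comm_ring_1 qsym \<Rightarrow> 'k qsym2"  (\<open>\<Delta>\<close>)
  where "\<Delta> f = (\<Sum>\<alpha> | \<alpha> \<in> Comp \<and> M_coeff \<alpha> f \<noteq> 0.
    scale_qsym2 (M_coeff \<alpha> f) (\<Sum>(\<beta>, \<gamma>)\<in>comp_splits \<alpha>. M \<beta> \<otimes> M \<gamma>))"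

lemma coproduct_superset:
  assumes "finite A" "A \<subseteq> Comp" "\<And>\<alpha>. \<alpha> \<in> Comp \<Longrightarrow> M_coeff \<alpha> f \<noteq> 0 \<Longrightarrow> \<alpha> \<in> A"
  shows "\<Delta> f = (\<Sum>\<alpha>\<in>A. scale_qsym2 (M_coeff \<alpha> f) (\<Sum>(\<beta>, \<gamma>)\<in>comp_splits \<alpha>. M \<beta> \<otimes> M \<gamma>))"
  unfolding coproduct_def using assms by (intro sum.mono_neutral_left) auto

lemma coproduct_M:
  assumes "\<alpha> \<in> Comp"
  shows "\<Delta> (M \<alpha>) = (\<Sum>(\<beta>, \<gamma>)\<in>comp_splits \<alpha>. M \<beta> \<otimes> M \<gamma>)"
proof -
  have "\<Delta> (M \<alpha>) = (\<Sum>\<alpha>'\<in>{\<alpha>}. scale_qsym2 (M_coeff \<alpha>' (M \<alpha>))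
      (\<Sum>(\<beta>, \<gamma>)\<in>comp_splits \<alpha>'. M \<beta> \<otimes> M \<gamma>))"
    using assms by (intro coproduct_superset) (auto simp: M_coeff_M split: if_splits)
  then show ?thesis using assms by (simp add: M_coeff_M)
qed

lemma coproduct_linear: "module_hom scale_qsym scale_qsym2 (\<Delta> :: 'k::comm_ring_1 qsym \<Rightarrow> _)"
proof unfold_locales
  fix f g :: "'k qsym" and c :: 'k
  let ?A = "{\<alpha>\<in>Comp. M_coeff \<alpha> f \<noteq> 0} \<union> {\<alpha>\<in>Comp. M_coeff \<alpha> g \<noteq> 0}"
  have A: "finite ?A" by (simp add: finite_M_support)
  define S where "S \<alpha> = (\<Sum>(\<beta>, \<gamma>)\<in>comp_splits \<alpha>. M \<beta> \<otimes> M \<gamma> :: 'k qsym2)" for \<alpha>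
  have \<Delta>: "\<Delta> h = (\<Sum>\<alpha>\<in>?A. scale_qsym2 (M_coeff \<alpha> h) (S \<alpha>))"
    if "h \<in> {f, g, f + g, scale_qsym c f}" for h
    unfolding S_def using A that
    by (intro coproduct_superset) (auto simp: M_coeff_add M_coeff_scale)
  show "\<Delta> (f + g) = \<Delta> f + \<Delta> g"
    by (simp only: \<Delta> insert_iff simp_thms M_coeff_add qsym2.scale_left_distrib sum.distrib)
  show "\<Delta> (scale_qsym c f) = scale_qsym2 c (\<Delta> f)"
    by (simp only: \<Delta> insert_iff simp_thms M_coeff_scale qsym2.scale_sum_right qsym2.scale_scale)
qed

text \<open>The image of the canonical map \<open>D \<otimes> D \<rightarrow> QSym \<otimes> QSym\<close>, which need not be injective,
  is the submodule generated by the pure tensors.\<close>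

definition subcoalgebra :: "'k::comm_ring_1 qsym set \<Rightarrow> bool"
  where "subcoalgebra D \<longleftrightarrow>
    qsym.subspace D \<and> \<Delta> ` D \<subseteq> qsym2.span {f \<otimes> g | f g. f \<in> D \<and> g \<in> D}"


section \<open>The family \<open>\<eta>\<close>\<close>

definition eta :: "'k::comm_ring_1 \<Rightarrow> nat list \<Rightarrow> 'k qsym"  (\<open>\<eta>\<close>)
  where "\<eta> q \<alpha> = (\<Sum>\<beta> | \<beta> \<in> Comp_of_size (sum_list \<alpha>) \<and> partial_sums \<beta> \<subseteq> partial_sums \<alpha>.
    scale_qsym ((q + 1) ^ length \<beta>) (M \<beta>))"

definition QSym_T :: "'k::comm_ring_1 \<Rightarrow> nat list set \<Rightarrow> 'k qsym set"
  where "QSym_T q T = qsym.span (\<eta> q ` T)"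

end

theory Submission
  imports Defs
begin

text \<open>Call \<open>\<beta>\<close> a coarsening of \<open>\<alpha>\<close> if it arises from \<open>\<alpha>\<close> by adding up blocks of consecutive
  entries; for compositions of the same size this is \<open>D(\<beta>) \<subseteq> D(\<alpha>)\<close>, and so \<open>\<eta> q \<alpha>\<close> is the sum of
  \<open>r\<^bsup>\<ell>(\<beta>)\<^esup> M \<beta>\<close> over the coarsenings \<open>\<beta>\<close> of \<open>\<alpha>\<close>, where \<open>r = q + 1\<close>.

  Everything rests on the formula \<open>\<Delta> (\<eta> q \<alpha>) = \<Sum> \<eta> q \<beta> \<otimes> \<eta> q \<gamma>\<close>, summed over all ways to write
  \<open>\<alpha> = \<beta>\<gamma>\<close> (\<open>coproduct_eta\<close>). It holds because cutting a coarsening of \<open>\<alpha>\<close> into two pieces amounts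
  to cutting \<open>\<alpha>\<close> at the same place and coarsening the two parts separately
  (\<open>bij_betw_split_coarsenings\<close>), while the weight \<open>r\<^bsup>\<ell>(\<beta>)\<^esup>\<close> is multiplicative under concatenation.
  If \<open>T\<close> is closed under prefixes and suffixes, then every term of the formula for \<open>\<alpha> \<in> T\<close> is a
  tensor of two elements of \<open>QSym_T q T\<close>, so this span is a subcoalgebra; the set \<open>Y\<^sup>*\<close> is closed in
  this sense.

  For the converse, let \<open>r\<close> be invertible. Since \<open>\<eta> q \<alpha>\<close> is \<open>r\<^bsup>\<ell>(\<alpha>)\<^esup> M \<alpha>\<close> plus terms \<open>M \<beta>\<close> with
  \<open>\<beta>\<close> shorter, there are linear forms \<open>e\<^sub>\<beta>\<close> with \<open>e\<^sub>\<beta> (\<eta> q \<alpha>) = 1\<close> for \<open>\<alpha> = \<beta>\<close> and \<open>0\<close> otherwise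
  (\<open>eta_dual_eta\<close>). By the coproduct formula the linear form \<open>e\<^sub>\<beta> \<otimes> e\<^sub>\<gamma>\<close> takes the value \<open>1\<close> at
  \<open>\<Delta> (\<eta> q (\<beta>\<gamma>))\<close>. But if \<open>\<beta> \<notin> T\<close> or \<open>\<gamma> \<notin> T\<close>, then one of \<open>e\<^sub>\<beta>\<close>, \<open>e\<^sub>\<gamma>\<close> vanishes on \<open>QSym_T q T\<close>,
  hence \<open>e\<^sub>\<beta> \<otimes> e\<^sub>\<gamma>\<close> vanishes on all tensors of elements of \<open>QSym_T q T\<close>; so a subcoalgebra
  \<open>QSym_T q T\<close> cannot contain \<open>\<eta> q (\<beta>\<gamma>)\<close>.\<close>


section \<open>Coarsenings of compositions\<close>

text \<open>For a composition \<open>\<alpha>\<close> of \<open>n\<close> this is \<open>D(\<alpha>) \<union> {0, n}\<close>. Including both ends makes the set behave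
  uniformly under concatenation, without exceptions for empty factors.\<close>

definition cuts :: "nat list \<Rightarrow> nat set"
  where "cuts \<alpha> = (\<lambda>i. sum_list (take i \<alpha>)) ` {..length \<alpha>}"

definition coarsenings :: "nat list \<Rightarrow> nat list set"
  where "coarsenings \<alpha> =
    {\<beta>. \<beta> \<in> Comp_of_size (sum_list \<alpha>) \<and> partial_sums \<beta> \<subseteq> partial_sums \<alpha>}"

lemma Comp_append_iff: "\<alpha> @ \<beta> \<in> Comp \<longleftrightarrow> \<alpha> \<in> Comp \<and> \<beta> \<in> Comp"
  by (auto simp: Comp_def)

lemma Comp_Cons_iff: "a # \<alpha> \<in> Comp \<longleftrightarrow> 0 < a \<and> \<alpha> \<in> Comp"
  by (auto simp: Comp_def)

lemma cuts_Nil: "cuts [] = {0}"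
  by (simp add: cuts_def)

lemma cuts_Cons: "cuts (a # \<alpha>) = insert 0 ((+) a ` cuts \<alpha>)"
  by (simp add: cuts_def atMost_Suc_eq_insert_0 image_image)

lemma zero_in_cuts: "0 \<in> cuts \<alpha>"
  by (cases \<alpha>) (simp_all add: cuts_Nil cuts_Cons)

lemma cuts_append: "cuts (\<alpha> @ \<beta>) = cuts \<alpha> \<union> (+) (sum_list \<alpha>) ` cuts \<beta>"
proof (induction \<alpha>)
  case Nil
  then show ?case using zero_in_cuts[of \<beta>] by (auto simp: cuts_Nil image_def)
next
  case (Cons a \<alpha>)
  then show ?case by (simp add: cuts_Cons image_Un image_image add.assoc)
qed

lemma sum_list_in_cuts: "sum_list \<alpha> \<in> cuts \<alpha>"
  by (induction \<alpha>) (auto simp: cuts_Nil cuts_Cons)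

lemma cuts_le: "x \<in> cuts \<alpha> \<Longrightarrow> x \<le> sum_list \<alpha>"
  by (induction \<alpha> arbitrary: x) (auto simp: cuts_Nil cuts_Cons)

lemma finite_cuts: "finite (cuts \<alpha>)"
  by (simp add: cuts_def)

lemma cut_splits:
  assumes "x \<in> cuts \<alpha>"
  obtains \<beta> \<gamma> where "\<alpha> = \<beta> @ \<gamma>" "sum_list \<beta> = x"
proof -
  obtain i where "x = sum_list (take i \<alpha>)" using assms by (auto simp: cuts_def)
  then show ?thesis using that[of "take i \<alpha>" "drop i \<alpha>"] by simp
qed

text \<open>Positivity of the entries keeps the cuts distinct. Since the cuts also determine the composition,
  a proper coarsening has strictly fewer of them and is strictly shorter.\<close>

lemma card_cuts: "\<alpha> \<in> Comp \<Longrightarrow> card (cuts \<alpha>) = Suc (length \<alpha>)"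
proof (induction \<alpha>)
  case (Cons a \<alpha>)
  then have "0 \<notin> (+) a ` cuts \<alpha>" by (auto simp: Comp_Cons_iff)
  then show ?case
    using Cons by (simp add: cuts_Cons finite_cuts card_image Comp_Cons_iff)
qed (simp add: cuts_Nil)

lemma cuts_inject: "\<alpha> \<in> Comp \<Longrightarrow> \<beta> \<in> Comp \<Longrightarrow> cuts \<alpha> = cuts \<beta> \<Longrightarrow> \<alpha> = \<beta>"
proof (induction \<alpha> arbitrary: \<beta>)
  case Nil
  then have "card (cuts \<beta>) = 1" by (metis cuts_Nil card_1_singleton_iff One_nat_def)
  then show ?case using Nil card_cuts[of \<beta>] by simp
next
  case (Cons a \<alpha>)
  have "\<beta> \<noteq> []"
    using Cons.prems card_cuts[of "a # \<alpha>"] by (auto simp: cuts_Nil)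
  then obtain b \<beta>' where \<beta>: "\<beta> = b # \<beta>'" by (cases \<beta>) auto
  have pos: "0 < a" "0 < b" and C: "\<alpha> \<in> Comp" "\<beta>' \<in> Comp"
    using Cons.prems by (auto simp: \<beta> Comp_Cons_iff)
  \<comment> \<open>The first entry is the least nonzero cut.\<close>
  have "a \<in> cuts (a # \<alpha>)" "b \<in> cuts (b # \<beta>')"
    using zero_in_cuts by (simp_all add: cuts_Cons image_iff)
  then have "a \<in> cuts (b # \<beta>')" "b \<in> cuts (a # \<alpha>)"
    using Cons.prems(3) by (simp_all add: \<beta>)
  then have ab: "a = b" using pos by (auto simp: cuts_Cons)
  have "0 \<notin> (+) a ` cuts \<alpha>" "0 \<notin> (+) a ` cuts \<beta>'" using pos by auto
  then have "(+) a ` cuts \<alpha> = (+) a ` cuts \<beta>'"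
    using Cons.prems(3) by (metis \<beta> ab cuts_Cons insert_ident)
  then have "cuts \<alpha> = cuts \<beta>'"
    by (simp add: inj_image_eq_iff)
  then show ?case using Cons.IH C \<beta> ab by simp
qed

lemma cuts_eq_partial_sums: "cuts \<alpha> = partial_sums \<alpha> \<union> {0, sum_list \<alpha>}"
proof -
  have "{..length \<alpha>} = {1..length \<alpha> - 1} \<union> {0, length \<alpha>}" by auto
  then show ?thesis
    by (auto simp: cuts_def partial_sums_def)
qed

lemma partial_sums_inner:
  assumes "\<alpha> \<in> Comp" "x \<in> partial_sums \<alpha>"
  shows "0 < x" "x < sum_list \<alpha>"
proof -
  obtain i where i: "x = sum_list (take i \<alpha>)" "1 \<le> i" "i \<le> length \<alpha> - 1"
    using assms(2) by (auto simp: partial_sums_def)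
  have "take i \<alpha> \<in> Comp" "drop i \<alpha> \<in> Comp"
    using assms(1) by (metis append_take_drop_id Comp_append_iff)+
  then have "length (take i \<alpha>) \<le> x" "length (drop i \<alpha>) \<le> sum_list (drop i \<alpha>)"
    using length_le_sum_list i(1) by blast+
  moreover have "sum_list \<alpha> = x + sum_list (drop i \<alpha>)"
    using i(1) by (metis append_take_drop_id sum_list_append)
  ultimately show "0 < x" "x < sum_list \<alpha>" using i by auto
qed

lemma coarsenings_iff:
  "\<beta> \<in> coarsenings \<alpha> \<longleftrightarrow> \<beta> \<in> Comp \<and> sum_list \<beta> = sum_list \<alpha> \<and> cuts \<beta> \<subseteq> cuts \<alpha>"
  using partial_sums_inner[of \<beta>]
  by (fastforce simp: coarsenings_def Comp_of_size_def cuts_eq_partial_sums)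

lemma finite_coarsenings: "finite (coarsenings \<alpha>)"
  unfolding coarsenings_def using finite_Comp_of_size by (rule rev_finite_subset) auto

lemma coarsenings_self: "\<alpha> \<in> Comp \<Longrightarrow> \<alpha> \<in> coarsenings \<alpha>"
  by (simp add: coarsenings_iff)

lemma coarsening_shorter:
  assumes "\<alpha> \<in> Comp" "\<beta> \<in> coarsenings \<alpha>" "\<beta> \<noteq> \<alpha>"
  shows "length \<beta> < length \<alpha>"
proof -
  have "cuts \<beta> \<subset> cuts \<alpha>"
    using assms cuts_inject by (auto simp: coarsenings_iff)
  then have "card (cuts \<beta>) < card (cuts \<alpha>)"
    using finite_cuts psubset_card_mono by blast
  then show ?thesis using assms card_cuts by (simp add: coarsenings_iff)
qed

lemma coarsenings_append:
  assumes "\<beta> \<in> coarsenings \<alpha>" "\<beta>' \<in> coarsenings \<alpha>'"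
  shows "\<beta> @ \<beta>' \<in> coarsenings (\<alpha> @ \<alpha>')"
  using assms by (auto simp: coarsenings_iff Comp_append_iff cuts_append)

text \<open>The size of \<open>\<beta>\<close> is a cut of \<open>\<beta> @ \<beta>'\<close>, hence of \<open>\<alpha>\<close>, so \<open>\<alpha>\<close> can be split there. The cuts of \<open>\<alpha>\<close>
  up to that point are those of the first factor, the cuts from that point on are the shifted cuts
  of the second.\<close>

lemma coarsening_splits:
  assumes "\<beta> @ \<beta>' \<in> coarsenings \<alpha>"
  obtains \<alpha>\<^sub>1 \<alpha>\<^sub>2 where "\<alpha> = \<alpha>\<^sub>1 @ \<alpha>\<^sub>2" "\<beta> \<in> coarsenings \<alpha>\<^sub>1" "\<beta>' \<in> coarsenings \<alpha>\<^sub>2"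
proof -
  let ?n = "sum_list \<beta>"
  have \<beta>: "\<beta> \<in> Comp" "\<beta>' \<in> Comp" "?n + sum_list \<beta>' = sum_list \<alpha>"
    and sub: "cuts \<beta> \<union> (+) ?n ` cuts \<beta>' \<subseteq> cuts \<alpha>"
    using assms by (auto simp: coarsenings_iff Comp_append_iff cuts_append)
  have "?n \<in> cuts \<alpha>" using sub sum_list_in_cuts[of \<beta>] by blast
  then obtain \<alpha>\<^sub>1 \<alpha>\<^sub>2 where \<alpha>: "\<alpha> = \<alpha>\<^sub>1 @ \<alpha>\<^sub>2" "sum_list \<alpha>\<^sub>1 = ?n"
    by (rule cut_splits)
  have cuts: "cuts \<alpha> = cuts \<alpha>\<^sub>1 \<union> (+) ?n ` cuts \<alpha>\<^sub>2"
    using \<alpha> by (simp add: cuts_append)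
  have "cuts \<beta> \<subseteq> cuts \<alpha>\<^sub>1"
  proof
    fix x assume x: "x \<in> cuts \<beta>"
    then have "x \<le> ?n" "x \<in> cuts \<alpha>" using cuts_le sub by auto
    then show "x \<in> cuts \<alpha>\<^sub>1"
      using \<alpha>(2) sum_list_in_cuts[of \<alpha>\<^sub>1] by (auto simp: cuts)
  qed
  moreover have "cuts \<beta>' \<subseteq> cuts \<alpha>\<^sub>2"
  proof
    fix x assume x: "x \<in> cuts \<beta>'"
    then have "?n + x \<in> cuts \<alpha>" using sub by auto
    then consider "?n + x \<in> cuts \<alpha>\<^sub>1" | "x \<in> cuts \<alpha>\<^sub>2" by (auto simp: cuts)
    then show "x \<in> cuts \<alpha>\<^sub>2"
    proof cases
      case 1
      then have "x = 0" using cuts_le[of "?n + x" \<alpha>\<^sub>1] \<alpha>(2) by simp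
      then show ?thesis by (simp add: zero_in_cuts)
    qed
  qed
  ultimately show ?thesis
    using that \<alpha> \<beta> by (simp add: coarsenings_iff)
qed

text \<open>As the entries are positive, the place where a composition is split is determined by the sum
  of the entries before it.\<close>

lemma append_eq_append_sum_list:
  fixes \<alpha>\<^sub>1 :: "nat list"
  assumes "\<alpha>\<^sub>1 @ \<alpha>\<^sub>2 = \<beta>\<^sub>1 @ \<beta>\<^sub>2" "sum_list \<alpha>\<^sub>1 = sum_list \<beta>\<^sub>1" "\<alpha>\<^sub>1 @ \<alpha>\<^sub>2 \<in> Comp"
  shows "\<alpha>\<^sub>1 = \<beta>\<^sub>1 \<and> \<alpha>\<^sub>2 = \<beta>\<^sub>2"
  using assms
proof (induction \<alpha>\<^sub>1 arbitrary: \<beta>\<^sub>1)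
  case Nil
  then show ?case by (cases \<beta>\<^sub>1) (auto simp: Comp_Cons_iff)
next
  case (Cons a \<alpha>\<^sub>1)
  then show ?case by (cases \<beta>\<^sub>1) (auto simp: Comp_Cons_iff)
qed

text \<open>Splitting a coarsening and coarsening the parts of a split are the same thing. The second
  component \<open>(\<beta>, \<beta>')\<close> is carried along unchanged, since it is what the summands of the coproduct
  depend on.\<close>

lemma bij_betw_split_coarsenings:
  assumes "\<alpha> \<in> Comp"
  shows "bij_betw (\<lambda>((\<alpha>\<^sub>1, \<alpha>\<^sub>2), (\<beta>, \<beta>')). (\<beta> @ \<beta>', (\<beta>, \<beta>')))
    (SIGMA (\<alpha>\<^sub>1, \<alpha>\<^sub>2):comp_splits \<alpha>. coarsenings \<alpha>\<^sub>1 \<times> coarsenings \<alpha>\<^sub>2)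
    (SIGMA \<beta>:coarsenings \<alpha>. comp_splits \<beta>)"
  unfolding bij_betw_def
proof
  show "inj_on (\<lambda>((\<alpha>\<^sub>1, \<alpha>\<^sub>2), (\<beta>, \<beta>')). (\<beta> @ \<beta>', (\<beta>, \<beta>')))
    (SIGMA (\<alpha>\<^sub>1, \<alpha>\<^sub>2):comp_splits \<alpha>. coarsenings \<alpha>\<^sub>1 \<times> coarsenings \<alpha>\<^sub>2)"
  proof -
    have unique: "\<alpha>\<^sub>1 = \<alpha>\<^sub>1' \<and> \<alpha>\<^sub>2 = \<alpha>\<^sub>2'"
      if "(\<alpha>\<^sub>1, \<alpha>\<^sub>2) \<in> comp_splits \<alpha>" "(\<alpha>\<^sub>1', \<alpha>\<^sub>2') \<in> comp_splits \<alpha>"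
        "\<beta> \<in> coarsenings \<alpha>\<^sub>1" "\<beta> \<in> coarsenings \<alpha>\<^sub>1'" for \<alpha>\<^sub>1 \<alpha>\<^sub>2 \<alpha>\<^sub>1' \<alpha>\<^sub>2' \<beta>
      by (rule append_eq_append_sum_list)
        (use assms that in \<open>simp_all add: comp_splits_def coarsenings_iff\<close>)
    show ?thesis
      by (intro inj_onI) (clarsimp, use unique in blast)
  qed
  show "(\<lambda>((\<alpha>\<^sub>1, \<alpha>\<^sub>2), (\<beta>, \<beta>')). (\<beta> @ \<beta>', (\<beta>, \<beta>'))) `
      (SIGMA (\<alpha>\<^sub>1, \<alpha>\<^sub>2):comp_splits \<alpha>. coarsenings \<alpha>\<^sub>1 \<times> coarsenings \<alpha>\<^sub>2)
    = (SIGMA \<beta>:coarsenings \<alpha>. comp_splits \<beta>)" (is "?f ` ?A = ?B")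
  proof
    show "?f ` ?A \<subseteq> ?B"
    proof clarify
      fix \<alpha>\<^sub>1 \<alpha>\<^sub>2 \<beta> \<beta>'
      assume *: "(\<alpha>\<^sub>1, \<alpha>\<^sub>2) \<in> comp_splits \<alpha>" "\<beta> \<in> coarsenings \<alpha>\<^sub>1" "\<beta>' \<in> coarsenings \<alpha>\<^sub>2"
      then have "\<beta> @ \<beta>' \<in> coarsenings \<alpha>"
        using coarsenings_append by (auto simp: comp_splits_def)
      then show "\<beta> @ \<beta>' \<in> coarsenings \<alpha> \<and> (\<beta>, \<beta>') \<in> comp_splits (\<beta> @ \<beta>')"
        using * by (auto simp: comp_splits_def coarsenings_iff)
    qed
    show "?B \<subseteq> ?f ` ?A"
    proof clarify
      fix \<delta> \<beta> \<beta>' assume *: "\<delta> \<in> coarsenings \<alpha>" "(\<beta>, \<beta>') \<in> comp_splits \<delta>"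
      then have \<delta>: "\<delta> = \<beta> @ \<beta>'" by (simp add: comp_splits_def)
      with * obtain \<alpha>\<^sub>1 \<alpha>\<^sub>2
        where s: "\<alpha> = \<alpha>\<^sub>1 @ \<alpha>\<^sub>2" "\<beta> \<in> coarsenings \<alpha>\<^sub>1" "\<beta>' \<in> coarsenings \<alpha>\<^sub>2"
        by (blast elim: coarsening_splits)
      then have "((\<alpha>\<^sub>1, \<alpha>\<^sub>2), (\<beta>, \<beta>')) \<in> ?A"
        using assms by (auto simp: comp_splits_def Comp_append_iff)
      moreover have "(\<delta>, \<beta>, \<beta>') = ?f ((\<alpha>\<^sub>1, \<alpha>\<^sub>2), (\<beta>, \<beta>'))" by (simp add: \<delta>)
      ultimately show "(\<delta>, \<beta>, \<beta>') \<in> ?f ` ?A" by (rule rev_image_eqI)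
    qed
  qed
qed


section \<open>The coproduct on the family \<open>\<eta>\<close>\<close>

lemma eta_eq: "\<eta> q \<alpha> = (\<Sum>\<beta>\<in>coarsenings \<alpha>. scale_qsym ((q + 1) ^ length \<beta>) (M \<beta>))"
  by (simp add: eta_def coarsenings_def)

lemma tensor_sum_left: "(\<Sum>i\<in>A. f i) \<otimes> g = (\<Sum>i\<in>A. f i \<otimes> g)"
proof -
  interpret additive "\<lambda>f. f \<otimes> g" by unfold_locales (rule tensor_add_left)
  show ?thesis by (rule sum)
qed

lemma tensor_sum_right: "f \<otimes> (\<Sum>i\<in>A. g i) = (\<Sum>i\<in>A. f \<otimes> g i)"
proof -
  interpret additive "\<lambda>g. f \<otimes> g" by unfold_locales (rule tensor_add_right)
  show ?thesis by (rule sum)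
qed

lemma tensor_eta:
  "\<eta> q \<alpha> \<otimes> \<eta> q \<beta> = (\<Sum>(\<alpha>', \<beta>')\<in>coarsenings \<alpha> \<times> coarsenings \<beta>.
    scale_qsym2 ((q + 1) ^ length (\<alpha>' @ \<beta>')) (M \<alpha>' \<otimes> M \<beta>'))"
  unfolding eta_eq tensor_sum_left
  by (simp add: tensor_sum_right tensor_scale_left tensor_scale_right
      sum.cartesian_product power_add qsym2.scale_sum_right split_def mult.commute)

text \<open>Both sides expand into a weighted sum of tensors \<open>M \<beta> \<otimes> M \<gamma>\<close>: on the left over the coarsenings
  of \<open>\<alpha>\<close> and their splits, on the right over the splits of \<open>\<alpha>\<close> and the coarsenings of the two parts.
  The preceding bijection matches the terms.\<close>

lemma coproduct_eta:
  assumes "\<alpha> \<in> Comp"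
  shows "\<Delta> (\<eta> q \<alpha>) = (\<Sum>(\<beta>, \<gamma>)\<in>comp_splits \<alpha>. \<eta> q \<beta> \<otimes> \<eta> q \<gamma>)"
proof -
  interpret \<Delta>: module_hom scale_qsym scale_qsym2 "\<Delta> :: 'a qsym \<Rightarrow> _"
    by (rule coproduct_linear)
  let ?g = "\<lambda>(\<delta>, (\<beta>, \<gamma>)). scale_qsym2 ((q + 1) ^ length \<delta>) (M \<beta> \<otimes> M \<gamma>)"
  have "\<Delta> (\<eta> q \<alpha>) = (\<Sum>\<delta>\<in>coarsenings \<alpha>. \<Sum>p\<in>comp_splits \<delta>. ?g (\<delta>, p))"
    by (auto simp: eta_eq \<Delta>.sum \<Delta>.scale coproduct_M coarsenings_iff qsym2.scale_sum_right split_def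
        intro!: sum.cong)
  also have "\<dots> = sum ?g (SIGMA \<delta>:coarsenings \<alpha>. comp_splits \<delta>)"
    by (subst sum.Sigma) (simp_all add: finite_coarsenings finite_comp_splits)
  also have "\<dots> = (\<Sum>x\<in>(SIGMA (\<alpha>\<^sub>1, \<alpha>\<^sub>2):comp_splits \<alpha>. coarsenings \<alpha>\<^sub>1 \<times> coarsenings \<alpha>\<^sub>2).
      ?g ((\<lambda>((\<alpha>\<^sub>1, \<alpha>\<^sub>2), (\<beta>, \<beta>')). (\<beta> @ \<beta>', (\<beta>, \<beta>'))) x))"
    by (rule sum.reindex_bij_betw[OF bij_betw_split_coarsenings[OF assms], symmetric])
  also have "\<dots> = (\<Sum>(p, (\<beta>, \<gamma>))\<in>(SIGMA (\<alpha>\<^sub>1, \<alpha>\<^sub>2):comp_splits \<alpha>. coarsenings \<alpha>\<^sub>1 \<times> coarsenings \<alpha>\<^sub>2).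
      scale_qsym2 ((q + 1) ^ length (\<beta> @ \<gamma>)) (M \<beta> \<otimes> M \<gamma>))"
    by (rule sum.cong) auto
  also have "\<dots> = (\<Sum>(\<alpha>\<^sub>1, \<alpha>\<^sub>2)\<in>comp_splits \<alpha>. \<eta> q \<alpha>\<^sub>1 \<otimes> \<eta> q \<alpha>\<^sub>2)"
    by (subst sum.Sigma[symmetric])
      (auto simp: finite_coarsenings finite_comp_splits tensor_eta intro!: sum.cong)
  finally show ?thesis .
qed

text \<open>By linearity of \<open>\<Delta>\<close> it is enough to look at the generators \<open>\<eta> q \<alpha>\<close>, where the coproduct formula
  only involves factors of \<open>\<alpha>\<close>.\<close>

lemma subcoalgebra_QSym_T:
  fixes q :: "'k::comm_ring_1"
  assumes "T \<subseteq> Comp" "\<forall>\<beta>\<in>Comp. \<forall>\<gamma>\<in>Comp. \<beta> @ \<gamma> \<in> T \<longrightarrow> \<beta> \<in> T \<and> \<gamma> \<in> T"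
  shows "subcoalgebra (QSym_T q T)"
proof -
  interpret \<Delta>: module_hom scale_qsym scale_qsym2 "\<Delta> :: 'k qsym \<Rightarrow> _"
    by (rule coproduct_linear)
  let ?S = "qsym2.span {f \<otimes> g | f g. f \<in> QSym_T q T \<and> g \<in> QSym_T q T}"
  have "\<Delta> (\<eta> q \<alpha>) \<in> ?S" if "\<alpha> \<in> T" for \<alpha>
  proof -
    have "\<eta> q \<beta> \<otimes> \<eta> q \<gamma> \<in> ?S" if "(\<beta>, \<gamma>) \<in> comp_splits \<alpha>" for \<beta> \<gamma>
    proof -
      have "\<beta> \<in> T" "\<gamma> \<in> T" using assms that \<open>\<alpha> \<in> T\<close> by (auto simp: comp_splits_def)
      then have "\<eta> q \<beta> \<in> QSym_T q T" "\<eta> q \<gamma> \<in> QSym_T q T"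
        unfolding QSym_T_def by (simp_all add: qsym.span_base)
      then show ?thesis by (blast intro: qsym2.span_base)
    qed
    then have "(\<Sum>(\<beta>, \<gamma>)\<in>comp_splits \<alpha>. \<eta> q \<beta> \<otimes> \<eta> q \<gamma>) \<in> ?S"
      by (intro qsym2.span_sum) auto
    then show ?thesis using that assms(1) by (subst coproduct_eta) auto
  qed
  then have "\<Delta> ` \<eta> q ` T \<subseteq> ?S" by blast
  then have "qsym2.span (\<Delta> ` \<eta> q ` T) \<subseteq> ?S"
    by (rule qsym2.span_minimal) (rule qsym2.subspace_span)
  then have "\<Delta> ` QSym_T q T \<subseteq> ?S"
    by (simp add: \<Delta>.span_image QSym_T_def)
  then show ?thesis
    by (simp add: subcoalgebra_def QSym_T_def qsym.subspace_span)
qed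


section \<open>Coordinate functionals for the family \<open>\<eta>\<close>\<close>

text \<open>The values at \<open>M \<alpha>\<close> of the linear form dual to \<open>\<eta> q \<beta>\<close>, with \<open>r = q + 1\<close> and \<open>s\<close> the inverse
  of \<open>r\<close>. They solve the triangular system \<open>\<Sum> r\<^bsup>\<ell>(\<delta>)\<^esup> w(\<delta>) = [\<alpha> = \<beta>]\<close>, \<open>\<delta>\<close> ranging over the coarsenings of
  \<open>\<alpha>\<close>: all \<open>\<delta>\<close> but \<open>\<alpha>\<close> are shorter than \<open>\<alpha>\<close>, so that the equation for \<open>\<alpha>\<close> can be solved for \<open>w(\<alpha>)\<close>.\<close>

function eta_dual_weight :: "'k::comm_ring_1 \<Rightarrow> 'k \<Rightarrow> nat list \<Rightarrow> nat list \<Rightarrow> 'k"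
  where "eta_dual_weight r s \<beta> \<alpha> = s ^ length \<alpha> * (of_bool (\<alpha> = \<beta>) -
    (\<Sum>\<delta> | \<delta> \<in> coarsenings \<alpha> \<and> length \<delta> < length \<alpha>.
      r ^ length \<delta> * eta_dual_weight r s \<beta> \<delta>))"
  by auto
termination by (relation "measure (\<lambda>(_, _, _, \<alpha>). length \<alpha>)") auto

declare eta_dual_weight.simps [simp del]

lemma sum_eta_dual_weight:
  assumes "r * s = 1" "\<alpha> \<in> Comp"
  shows "(\<Sum>\<delta>\<in>coarsenings \<alpha>. r ^ length \<delta> * eta_dual_weight r s \<beta> \<delta>) = of_bool (\<alpha> = \<beta>)"
proof -
  have "coarsenings \<alpha> = insert \<alpha> {\<delta>. \<delta> \<in> coarsenings \<alpha> \<and> length \<delta> < length \<alpha>}"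
    using assms(2) coarsening_shorter coarsenings_self by auto
  then have "(\<Sum>\<delta>\<in>coarsenings \<alpha>. r ^ length \<delta> * eta_dual_weight r s \<beta> \<delta>)
    = r ^ length \<alpha> * eta_dual_weight r s \<beta> \<alpha> +
      (\<Sum>\<delta> | \<delta> \<in> coarsenings \<alpha> \<and> length \<delta> < length \<alpha>. r ^ length \<delta> * eta_dual_weight r s \<beta> \<delta>)"
    by (metis (no_types, lifting) finite_coarsenings finite_insert mem_Collect_eq order_less_irrefl
        sum.insert)
  moreover have "r ^ length \<alpha> * (s ^ length \<alpha> * x) = x" for x
    using assms(1) by (metis mult.assoc mult_1 power_mult_distrib power_one)
  ultimately show ?thesis
    by (simp add: eta_dual_weight.simps[of r s \<beta> \<alpha>])
qed

text \<open>Summing only over compositions of the size of \<open>\<beta>\<close> keeps the sum finite for every \<open>f\<close>; the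
  dual form vanishes on the other homogeneous components.\<close>

definition eta_dual :: "'k::comm_ring_1 \<Rightarrow> 'k \<Rightarrow> nat list \<Rightarrow> 'k qsym \<Rightarrow> 'k"
  where "eta_dual r s \<beta> f =
    (\<Sum>\<delta>\<in>Comp_of_size (sum_list \<beta>). eta_dual_weight r s \<beta> \<delta> * M_coeff \<delta> f)"

lemma module_times: "module ((*) :: 'k::comm_ring_1 \<Rightarrow> _)"
  by unfold_locales (simp_all add: algebra_simps)

lemma eta_dual_linear: "module_hom scale_qsym (*) (eta_dual r s \<beta>)"
  by (simp add: module_hom_iff module_times qsym.module_axioms eta_dual_def M_coeff_add
      M_coeff_scale sum.distrib sum_distrib_left algebra_simps)

lemma M_coeff_eta:
  "\<delta> \<in> Comp \<Longrightarrow> M_coeff \<delta> (\<eta> q \<alpha>) = (if \<delta> \<in> coarsenings \<alpha> then (q + 1) ^ length \<delta> else 0)"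
proof -
  assume \<delta>: "\<delta> \<in> Comp"
  have "M_coeff \<delta> (\<eta> q \<alpha>)
      = (\<Sum>\<beta>\<in>coarsenings \<alpha>. if \<delta> = \<beta> then (q + 1) ^ length \<beta> else 0)"
    unfolding eta_eq M_coeff_sum M_coeff_scale
    by (rule sum.cong) (use \<delta> in \<open>auto simp: M_coeff_M coarsenings_iff\<close>)
  then show ?thesis by (simp add: finite_coarsenings)
qed

lemma eta_dual_eta:
  assumes "(q + 1) * s = 1" "\<alpha> \<in> Comp"
  shows "eta_dual (q + 1) s \<beta> (\<eta> q \<alpha>) = of_bool (\<alpha> = \<beta>)"
proof -
  let ?w = "eta_dual_weight (q + 1) s \<beta>" and ?C = "Comp_of_size (sum_list \<beta>)"
  have "eta_dual (q + 1) s \<beta> (\<eta> q \<alpha>)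
      = (\<Sum>\<delta>\<in>?C. if \<delta> \<in> coarsenings \<alpha> then (q + 1) ^ length \<delta> * ?w \<delta> else 0)"
    unfolding eta_dual_def
    by (rule sum.cong) (auto simp: M_coeff_eta Comp_of_size_def mult.commute)
  also have "\<dots> = (\<Sum>\<delta>\<in>?C \<inter> coarsenings \<alpha>. (q + 1) ^ length \<delta> * ?w \<delta>)"
    by (simp add: sum.inter_restrict finite_Comp_of_size)
  also have "\<dots> = of_bool (\<alpha> = \<beta>)"
  proof (cases "sum_list \<alpha> = sum_list \<beta>")
    case True
    then have "?C \<inter> coarsenings \<alpha> = coarsenings \<alpha>"
      by (auto simp: coarsenings_def)
    then show ?thesis using sum_eta_dual_weight[OF assms] by simp
  next
    case False
    then have "?C \<inter> coarsenings \<alpha> = {}"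
      by (auto simp: coarsenings_def Comp_of_size_def)
    then show ?thesis using False by auto
  qed
  finally show ?thesis .
qed


section \<open>Bilinear forms on the tensor square\<close>

text \<open>The linear extension of a map from the generators of a free module. Over the generators
  \<open>(f, g)\<close> of the tensor square it is the first step in turning a bilinear form into a linear one.\<close>

definition free_extend :: "('a \<Rightarrow> 'k::comm_ring_1) \<Rightarrow> ('a \<Rightarrow>\<^sub>0 'k) \<Rightarrow> 'k"
  where "free_extend b x = (\<Sum>p\<in>Poly_Mapping.keys x. Poly_Mapping.lookup x p * b p)"

lemma free_extend_superset:
  assumes "finite A" "Poly_Mapping.keys x \<subseteq> A"
  shows "free_extend b x = (\<Sum>p\<in>A. Poly_Mapping.lookup x p * b p)"
  unfolding free_extend_def using assms
  by (intro sum.mono_neutral_left) (auto simp: in_keys_iff)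

lemma free_extend_linear: "module_hom scale_free (*) (free_extend b)"
proof -
  have "free_extend b (x + y) = free_extend b x + free_extend b y" for x y
  proof -
    let ?A = "Poly_Mapping.keys x \<union> Poly_Mapping.keys y"
    show ?thesis
      using keys_add[of x y]
      by (simp add: free_extend_superset[of ?A] lookup_add distrib_right sum.distrib)
  qed
  moreover have "free_extend b (scale_free c x) = c * free_extend b x" for c x
    by (subst free_extend_superset[of "Poly_Mapping.keys x"])
      (auto simp: in_keys_iff lookup_scale_free free_extend_def sum_distrib_left mult.assoc)
  ultimately show ?thesis
    by (simp add: module_hom_iff module_times free.module_axioms)
qed

lemma free_extend_single: "free_extend b (Poly_Mapping.single p 1) = b p"
  by (simp add: free_extend_def)

text \<open>The universal property of the tensor square for scalar-valued forms: bilinearity says exactly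
  that the extension to the free module kills the relators, so it is constant on the classes of the
  quotient and may be evaluated at any representative.\<close>

lemma bilinear_form_lifts:
  fixes B :: "'k::comm_ring_1 qsym \<Rightarrow> 'k qsym \<Rightarrow> 'k"
  assumes left: "\<And>g. module_hom scale_qsym (*) (\<lambda>f. B f g)"
    and right: "\<And>f. module_hom scale_qsym (*) (B f)"
  obtains F where "module_hom scale_qsym2 (*) F" "\<And>f g. F (f \<otimes> g) = B f g"
proof -
  let ?\<phi> = "free_extend (case_prod B)"
  interpret \<phi>: module_hom scale_free "(*)" ?\<phi> by (rule free_extend_linear)
  have "?\<phi> x = 0" if "x \<in> bilinear_relators" for x
    using that unfolding bilinear_relators_def Let_def
    by (auto simp: \<phi>.diff \<phi>.scale free_extend_single module_hom.add[OF left] module_hom.add[OF right]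
        module_hom.scale[OF left] module_hom.scale[OF right])
  then have "?\<phi> x = 0" if "x \<in> free.span bilinear_relators" for x
    using \<phi>.eq_0_on_span that by blast
  then have rel: "?\<phi> x = ?\<phi> y" if "tensor_rel x y" for x y
    using that \<phi>.diff[of x y] by (simp add: tensor_rel_def)
  define F where "F x = ?\<phi> (rep_qsym2 x)" for x
  have F: "F (abs_qsym2 x) = ?\<phi> x" for x
    unfolding F_def by (rule rel) (metis Quotient3_qsym2 Quotient3_abs_rep qsym2.abs_eq_iff)
  have "F (x + y) = F x + F y" for x y
    by (induct x rule: qsym2.abs_induct, induct y rule: qsym2.abs_induct)
      (simp add: F plus_qsym2.abs_eq \<phi>.add)
  moreover have "F (scale_qsym2 c x) = c * F x" for c x
    by (induct x rule: qsym2.abs_induct) (simp add: F scale_qsym2.abs_eq \<phi>.scale)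
  ultimately have "module_hom scale_qsym2 (*) F"
    by (simp add: module_hom_iff module_times qsym2.module_axioms)
  moreover have "F (f \<otimes> g) = B f g" for f g
    by (simp add: tensor_def F free_extend_single)
  ultimately show ?thesis by (rule that)
qed

lemma tensor_functional:
  fixes u v :: "'k::comm_ring_1 qsym \<Rightarrow> 'k"
  assumes "module_hom scale_qsym (*) u" "module_hom scale_qsym (*) v"
  obtains F where "module_hom scale_qsym2 (*) F" "\<And>f g. F (f \<otimes> g) = u f * v g"
  by (rule bilinear_form_lifts[of "\<lambda>f g. u f * v g"])
    (use assms that in \<open>auto simp: module_hom_iff algebra_simps\<close>)


section \<open>Necessity of closure under factors\<close>

text \<open>The element \<open>\<Delta> (\<eta> q (\<beta> @ \<gamma>))\<close> is tested against the product of the forms dual to \<open>\<eta> q \<beta>\<close> and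
  \<open>\<eta> q \<gamma>\<close>. Only the split \<open>(\<beta>, \<gamma>)\<close> contributes to the value, which is therefore \<open>1\<close>. Were \<open>\<beta>\<close> or
  \<open>\<gamma>\<close> missing from \<open>T\<close>, the product would vanish on the span of tensors that contains this element.\<close>

lemma subcoalgebra_QSym_T_factors:
  fixes q :: "'k::comm_ring_1"
  assumes "T \<subseteq> Comp" "(q + 1) * s = 1" "subcoalgebra (QSym_T q T)"
    and \<beta>\<gamma>: "\<beta> \<in> Comp" "\<gamma> \<in> Comp" "\<beta> @ \<gamma> \<in> T"
  shows "\<beta> \<in> T \<and> \<gamma> \<in> T"
proof (rule ccontr)
  assume out: "\<not> (\<beta> \<in> T \<and> \<gamma> \<in> T)"
  let ?e = "eta_dual (q + 1) s" and ?D = "QSym_T q T"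
  have e: "module_hom scale_qsym (*) (?e \<delta>)" for \<delta>
    by (rule eta_dual_linear)
  obtain F where F: "module_hom scale_qsym2 (*) F" "\<And>f g. F (f \<otimes> g) = ?e \<beta> f * ?e \<gamma> g"
    using tensor_functional[OF e e] by blast
  interpret F: module_hom scale_qsym2 "(*)" F by (rule F)
  \<comment> \<open>A dual form indexed outside \<open>T\<close> kills every generator of \<open>QSym_T q T\<close>.\<close>
  have vanish: "?e \<delta> f = 0" if "\<delta> \<notin> T" "f \<in> ?D" for \<delta> f
    using that(2) unfolding QSym_T_def
    by (rule module_hom.eq_0_on_span[OF e, rotated])
      (use that(1) assms(1,2) in \<open>auto simp: eta_dual_eta\<close>)
  have "F x = 0" if "x \<in> qsym2.span {f \<otimes> g | f g. f \<in> ?D \<and> g \<in> ?D}" for x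
    using that by (rule F.eq_0_on_span[rotated]) (use out vanish F(2) in auto)
  moreover have "\<eta> q (\<beta> @ \<gamma>) \<in> ?D"
    unfolding QSym_T_def using \<beta>\<gamma>(3) by (intro qsym.span_base) auto
  ultimately have "F (\<Delta> (\<eta> q (\<beta> @ \<gamma>))) = 0"
    using assms(3) by (auto simp: subcoalgebra_def)
  moreover have "F (\<Delta> (\<eta> q (\<beta> @ \<gamma>))) = 1"
  proof -
    have "F (\<Delta> (\<eta> q (\<beta> @ \<gamma>))) = (\<Sum>p\<in>comp_splits (\<beta> @ \<gamma>). if p = (\<beta>, \<gamma>) then 1 else 0)"
      using \<beta>\<gamma> assms(2)
      by (auto simp: coproduct_eta Comp_append_iff F.sum F(2) eta_dual_eta comp_splits_def
          intro!: sum.cong)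
    also have "\<dots> = 1"
    proof -
      have "(\<beta>, \<gamma>) \<in> comp_splits (\<beta> @ \<gamma>)" using \<beta>\<gamma> by (simp add: comp_splits_def)
      then show ?thesis by (simp add: finite_comp_splits)
    qed
    finally show ?thesis .
  qed
  ultimately show False by simp
qed

theorem proposition6p2:
  fixes q :: "'k::comm_ring_1" and T :: "nat list set"
  assumes "T \<subseteq> Comp"
  shows "(\<forall>Y \<subseteq> {1..}. T = comp_star Y \<longrightarrow> subcoalgebra (QSym_T q T)) \<and>
    ((\<forall>\<beta>\<in>Comp. \<forall>\<gamma>\<in>Comp. \<beta> @ \<gamma> \<in> T \<longrightarrow> \<beta> \<in> T \<and> \<gamma> \<in> T) \<longrightarrow> subcoalgebra (QSym_T q T)) \<and>
    ((\<forall>x::'k. x \<noteq> 0 \<longrightarrow> (\<exists>y. x * y = 1)) \<and> q + 1 \<noteq> 0 \<and> subcoalgebra (QSym_T q T) \<longrightarrow>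
      (\<forall>\<beta>\<in>Comp. \<forall>\<gamma>\<in>Comp. \<beta> @ \<gamma> \<in> T \<longrightarrow> \<beta> \<in> T \<and> \<gamma> \<in> T))"
proof (intro conjI)
  have "\<beta> \<in> comp_star Y \<and> \<gamma> \<in> comp_star Y" if "\<beta> @ \<gamma> \<in> comp_star Y" for \<beta> \<gamma> Y
    using that by (auto simp: comp_star_def Comp_append_iff)
  then show "\<forall>Y \<subseteq> {1..}. T = comp_star Y \<longrightarrow> subcoalgebra (QSym_T q T)"
    using subcoalgebra_QSym_T[OF assms] by blast
  show "(\<forall>\<beta>\<in>Comp. \<forall>\<gamma>\<in>Comp. \<beta> @ \<gamma> \<in> T \<longrightarrow> \<beta> \<in> T \<and> \<gamma> \<in> T) \<longrightarrow> subcoalgebra (QSym_T q T)"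
    using subcoalgebra_QSym_T[OF assms] by blast
  show "(\<forall>x::'k. x \<noteq> 0 \<longrightarrow> (\<exists>y. x * y = 1)) \<and> q + 1 \<noteq> 0 \<and> subcoalgebra (QSym_T q T) \<longrightarrow>
      (\<forall>\<beta>\<in>Comp. \<forall>\<gamma>\<in>Comp. \<beta> @ \<gamma> \<in> T \<longrightarrow> \<beta> \<in> T \<and> \<gamma> \<in> T)"
    using subcoalgebra_QSym_T_factors[OF assms] by blast
qed

end
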